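(* For $c\in\mathbb{R}\setminus\{0\}$ let $d=\frac{\sigma}{2}-\frac{g}{\sigma}$ and $T_{c,d}=\inf\{t\ge 0: B_t=c+dt\}$, and let $$IL(t,P_t)=-\frac{1}{2P_0}e^{-\rho t}\left(\sqrt{D_tP_t}-\sqrt{P_0}\right)^2 .$$ Under the model and assumptions in the context, $\mathbb{E}\left[IL(T_{c,d},P_{T_{c,d}})\right]<0$ both when $c>0$ and when $c<0$.
   Context: Model. $B$ is a standard Brownian motion. The price $P_t$ of a liquid staking token in ETH satisfies $dP_t/P_t=g\,dt+\sigma\,dB_t$ with deterministic initial price $P_0$, $g\ge 0$, $\sigma>0$. $D_t=e^{-mt}$ with $m>0$ is an exit discount factor, $r\ge 0$ is the staking reward rate, $\rho\ge 0$ is the investor's discount rate. The token is either rebasing ($P_0=1$, $g=0$, $r>0$) or reward-bearing ($P_0>1$, $g>0$, $r=0$). Standing assumptions: - $r+g-\rho-m>\ln P_0>0$; - $\left(\frac{\sigma}{2}-\frac{g}{\sigma}\right)^2-2(g+r-m-\rho)>0$; - $\left(\frac{\sigma}{2}-\frac{g}{\sigma}\right)^2-\left(g-\frac14\sigma^2-m-2\rho\right)>0$; - $d=\frac{\sigma}{2}-\frac{g}{\sigma}>0$; - $\frac14\sigma^2-m>0$. With $L=P_0e^{\sigma c}$, $T_{c,d}$ is the first time $P$ reaches level $L$ (from below if $c>0$, from above if $c<0$). On $\{T_{c,d}=\infty\}$ the payoff is taken to be $0$, so that expectations are computed through the Laplace transform $\mathbb{E}(e^{-\lambda T_{c,d}})=\exp(-c(d+\sqrt{d^2+2\lambda}))$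 for $c>0$ and $\exp(-c(d-\sqrt{d^2+2\lambda}))$ for $c<0$. *)

theory Defs
  imports "HOL-Probability.Probability"
begin

text \<open>Processes are indexed by \<open>real\<close>; only times \<open>t \<ge> 0\<close> are relevant.\<close>

definition standard_brownian_motion :: "'a measure \<Rightarrow> (real \<Rightarrow> 'a \<Rightarrow> real) \<Rightarrow> bool" where
  "standard_brownian_motion M B \<longleftrightarrow>
     prob_space M \<and>
     (\<forall>t\<ge>0. B t \<in> borel_measurable M) \<and>
     (\<forall>\<omega>\<in>space M. B 0 \<omega> = 0) \<and>
     (\<forall>\<omega>\<in>space M. continuous_on {0..} (\<lambda>t. B t \<omega>)) \<and>
     (\<forall>s t. 0 \<le> s \<and> s < t \<longrightarrow>
        distributed M lborel (\<lambda>\<omega>. B t \<omega> - B s \<omega>) (normal_density 0 (sqrt (t - s)))) \<and>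
     (\<forall>(n::nat) u. 0 \<le> u 0 \<and> (\<forall>i<n. u i < u (Suc i)) \<longrightarrow>
        prob_space.indep_vars M (\<lambda>_. borel) (\<lambda>i \<omega>. B (u (Suc i)) \<omega> - B (u i) \<omega>) {..<n})"

text \<open>Sequences of partitions \<open>0 = u n 0 \<le> \<dots> \<le> u n (N n) = t\<close> whose mesh tends to \<open>0\<close>.\<close>

definition vanishing_partitions :: "real \<Rightarrow> (nat \<Rightarrow> nat) \<Rightarrow> (nat \<Rightarrow> nat \<Rightarrow> real) \<Rightarrow> bool" where
  "vanishing_partitions t N u \<longleftrightarrow>
     (\<forall>n. u n 0 = 0 \<and> u n (N n) = t \<and> (\<forall>i<N n. u n i \<le> u n (Suc i))) \<and>
     (\<forall>\<epsilon>>0. \<forall>\<^sub>F n in sequentially. \<forall>i<N n. u n (Suc i) - u n i < \<epsilon>)"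

definition tendsto_in_probability :: "'a measure \<Rightarrow> (nat \<Rightarrow> 'a \<Rightarrow> real) \<Rightarrow> ('a \<Rightarrow> real) \<Rightarrow> bool" where
  "tendsto_in_probability M X Y \<longleftrightarrow>
     (\<forall>\<epsilon>>0. (\<lambda>n. measure M {\<omega> \<in> space M. \<epsilon> < \<bar>X n \<omega> - Y \<omega>\<bar>}) \<longlonglongrightarrow> 0)"

text \<open>\<open>Y\<close> is the Ito integral of \<open>H\<close> with respect to \<open>X\<close> over \<open>[0, t]\<close>. For a continuous adapted
  integrand and a continuous semimartingale integrator, the Ito integral is the limit in
  probability of the left-endpoint Riemann sums, for every sequence of partitions with vanishing
  mesh; this is taken as the definition. Adaptedness is not part of the definition, so hypotheses
  of this form cover every adapted process.\<close>

definition has_ito_integral ::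
    "'a measure \<Rightarrow> (real \<Rightarrow> 'a \<Rightarrow> real) \<Rightarrow> (real \<Rightarrow> 'a \<Rightarrow> real) \<Rightarrow> real \<Rightarrow> ('a \<Rightarrow> real) \<Rightarrow> bool" where
  "has_ito_integral M H X t Y \<longleftrightarrow>
     (\<forall>N u. vanishing_partitions t N u \<longrightarrow>
        tendsto_in_probability M
          (\<lambda>n \<omega>. \<Sum>i<N n. H (u n i) \<omega> * (X (u n (Suc i)) \<omega> - X (u n i) \<omega>)) Y)"

text \<open>A continuous positive solution of \<open>dP\<^sub>t / P\<^sub>t = g dt + \<sigma> dB\<^sub>t\<close> with deterministic initial
  value \<open>p0\<close>. The equation is integrated as it stands: for all \<open>t \<ge> 0\<close>, the Ito integral of
  \<open>1 / P\<close> against \<open>P\<close> over \<open>[0, t]\<close> equals \<open>g t + \<sigma> B\<^sub>t\<close>.\<close>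

definition price_process ::
    "'a measure \<Rightarrow> (real \<Rightarrow> 'a \<Rightarrow> real) \<Rightarrow> real \<Rightarrow> real \<Rightarrow> real \<Rightarrow> (real \<Rightarrow> 'a \<Rightarrow> real) \<Rightarrow> bool" where
  "price_process M B p0 g \<sigma> P \<longleftrightarrow>
     (\<forall>t\<ge>0. P t \<in> borel_measurable M) \<and>
     (\<forall>\<omega>\<in>space M. P 0 \<omega> = p0) \<and>
     (\<forall>\<omega>\<in>space M. continuous_on {0..} (\<lambda>t. P t \<omega>)) \<and>
     (\<forall>\<omega>\<in>space M. \<forall>t\<ge>0. 0 < P t \<omega>) \<and>
     (\<forall>t\<ge>0. has_ito_integral M (\<lambda>s \<omega>. 1 / P s \<omega>) P t (\<lambda>\<omega>. g * t + \<sigma> * B t \<omega>))"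

text \<open>\<open>T\<^sub>c\<^sub>,\<^sub>d\<close>; the value is \<open>\<infinity>\<close> (the infimum of the empty set) if the line is never hit.\<close>

definition hitting_time :: "(real \<Rightarrow> 'a \<Rightarrow> real) \<Rightarrow> real \<Rightarrow> real \<Rightarrow> 'a \<Rightarrow> ereal" where
  "hitting_time B c d \<omega> = Inf {ereal t | t. 0 \<le> t \<and> B t \<omega> = c + d * t}"

definition exit_discount :: "real \<Rightarrow> real \<Rightarrow> real" where
  "exit_discount m t = exp (- m * t)"

definition impermanent_loss :: "real \<Rightarrow> real \<Rightarrow> real \<Rightarrow> real \<Rightarrow> real \<Rightarrow> real" where
  "impermanent_loss \<rho> m p0 t p =
     - (1 / (2 * p0)) * exp (- \<rho> * t) * (sqrt (exit_discount m t * p) - sqrt p0)\<^sup>2"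

text \<open>The payoff \<open>f (T, P\<^sub>T)\<close> at a random time \<open>T\<close>, taken to be \<open>0\<close> on \<open>{T = \<infinity>}\<close>.\<close>

definition stopped_payoff ::
    "(real \<Rightarrow> real \<Rightarrow> real) \<Rightarrow> (real \<Rightarrow> 'a \<Rightarrow> real) \<Rightarrow> ('a \<Rightarrow> ereal) \<Rightarrow> 'a \<Rightarrow> real" where
  "stopped_payoff f P T \<omega> =
     (if T \<omega> = \<infinity> then 0 else f (real_of_ereal (T \<omega>)) (P (real_of_ereal (T \<omega>)) \<omega>))"

end

theory Submission
  imports Defs
begin

text \<open>The Laplace transform of the hitting time is not needed.

  With \<open>x = ln P\<close> the Riemann sums defining the Ito integral of \<open>1 / P\<close> against \<open>P\<close> equal
  \<open>x t - x 0\<close> plus the sum of \<open>exp \<Delta>x - 1 - \<Delta>x\<close>. Hence these nonnegative sums converge to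
  \<open>A t = g t + \<sigma> B t - (x t - x 0)\<close>, so \<open>A\<close> is increasing. Therefore \<open>x - \<sigma> B\<close> has bounded
  variation, \<open>x\<close> has the quadratic variation \<open>\<sigma>\<^sup>2 t\<close> of \<open>\<sigma> B\<close>, and \<open>A t = \<sigma>\<^sup>2 t / 2\<close>: the
  price is the geometric Brownian motion.

  Since \<open>\<sigma> d = \<sigma>\<^sup>2 / 2 - g\<close>, the price at the hitting time is almost surely the constant
  \<open>p0 exp (\<sigma> c)\<close>, so the nonpositive payoff is bounded. On \<open>{T < \<infinity>}\<close> it can vanish only for
  \<open>T = \<sigma> c / m\<close>, and the line is hit at an earlier time (at any time, if \<open>c < 0\<close>) with positive
  probability, because \<open>B t\<close> lies beyond the line with positive probability for every \<open>t > 0\<close>.\<close>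

section \<open>Almost sure convergence along subsequences\<close>

text \<open>Truncating the deviation at 1 turns convergence in probability into convergence in L1:
  the mean of the truncated deviation is at most \<open>e / 2\<close> plus the probability of a
  deviation above \<open>e / 2\<close>. An L1 null sequence has an almost surely null
  subsequence.\<close>

lemma tendsto_in_probability_AE_subseq:
  assumes "prob_space M"
    and X [measurable]: "\<And>n. X n \<in> borel_measurable M"
    and Y [measurable]: "Y \<in> borel_measurable M"
    and lim: "tendsto_in_probability M X Y"
  obtains s where "strict_mono s" "AE \<omega> in M. (\<lambda>n. X (s n) \<omega>) \<longlonglongrightarrow> Y \<omega>"
proof -
  interpret prob_space M by fact
  define U where "U n \<omega> = min 1 \<bar>X n \<omega> - Y \<omega>\<bar>" for n \<omega>
  have U_meas [measurable]: "U n \<in> borel_measurable M" for n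
    unfolding U_def by measurable
  have U_int: "integrable M (U n)" for n
    by (rule integrable_const_bound[where B=1]) (auto simp: U_def)
  have "(\<lambda>n. \<integral>\<omega>. norm (U n \<omega>) \<partial>M) \<longlonglongrightarrow> 0"
  proof (rule LIMSEQ_I)
    fix e :: real assume e: "0 < e"
    define A where "A n = {\<omega> \<in> space M. e / 2 < \<bar>X n \<omega> - Y \<omega>\<bar>}" for n
    have A_meas [measurable]: "A n \<in> sets M" for n
      unfolding A_def by measurable
    have "(\<lambda>n. prob (A n)) \<longlonglongrightarrow> 0"
      using lim[unfolded tendsto_in_probability_def, rule_format, of "e / 2"] e
      unfolding A_def by simp
    then obtain n0 where n0: "\<And>n. n \<ge> n0 \<Longrightarrow> prob (A n) < e / 2"
      using LIMSEQ_D[of "\<lambda>n. prob (A n)" 0 "e/2"] e by auto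
    have "(\<integral>\<omega>. norm (U n \<omega>) \<partial>M) < e" if "n \<ge> n0" for n
    proof -
      have "(\<integral>\<omega>. norm (U n \<omega>) \<partial>M) \<le> (\<integral>\<omega>. e / 2 + indicator (A n) \<omega> \<partial>M)"
      proof (rule integral_mono)
        show "norm (U n \<omega>) \<le> e / 2 + indicator (A n) \<omega>" if "\<omega> \<in> space M" for \<omega>
          using that e by (auto simp: U_def A_def indicator_def min_def)
      qed (use U_int in \<open>auto simp: emeasure_finite less_top[symmetric]\<close>)
      also have "\<dots> = e / 2 + prob (A n)"
        by (subst Bochner_Integration.integral_add)
          (auto simp: prob_space emeasure_finite less_top[symmetric])
      finally show ?thesis using n0[OF that] by simp
    qed
    moreover have "0 \<le> (\<integral>\<omega>. norm (U n \<omega>) \<partial>M)" for n by simp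
    ultimately show "\<exists>no. \<forall>n\<ge>no. norm ((\<integral>\<omega>. norm (U n \<omega>) \<partial>M) - 0) < e"
      by (intro exI[of _ n0]) auto
  qed
  from tendsto_L1_AE_subseq[OF U_int this] obtain s
    where s: "strict_mono s" "AE \<omega> in M. (\<lambda>n. U (s n) \<omega>) \<longlonglongrightarrow> 0"
    by auto
  have "AE \<omega> in M. (\<lambda>n. X (s n) \<omega>) \<longlonglongrightarrow> Y \<omega>"
    using s(2)
  proof eventually_elim
    case (elim \<omega>)
    \<comment> \<open>Below 1 the truncation is inactive, so \<open>U\<close> is eventually the
      deviation itself.\<close>
    have "\<forall>\<^sub>F n in sequentially. U (s n) \<omega> < 1"
      using elim by (rule order_tendstoD) simp
    then have "\<forall>\<^sub>F n in sequentially. U (s n) \<omega> = \<bar>X (s n) \<omega> - Y \<omega>\<bar>"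
      by eventually_elim (auto simp: U_def)
    then have "(\<lambda>n. \<bar>X (s n) \<omega> - Y \<omega>\<bar>) \<longlonglongrightarrow> 0"
      using elim by (blast intro: Lim_transform_eventually)
    then show ?case
      by (simp add: tendsto_rabs_zero_iff LIM_zero_iff)
  qed
  with s(1) show ?thesis by (rule that)
qed

section \<open>Partitions with vanishing mesh\<close>

text \<open>Each of \<open>a\<close> coarse steps of length \<open>h\<close> is cut into
  \<open>Suc (s n)\<close> equal cells. For fixed \<open>h\<close> and \<open>s\<close>, the grid of
  a smaller \<open>a\<close> is an initial segment of the grid of a larger one, so sums up to two
  different times can be compared term by term.\<close>

lemma vanishing_partitions_grid:
  assumes "0 \<le> h" "strict_mono s"
  shows "vanishing_partitions (h * real a) (\<lambda>n. a * Suc (s n)) (\<lambda>n i. h * real i / real (Suc (s n)))"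
proof -
  have "\<forall>\<^sub>F n in sequentially. \<forall>i<a * Suc (s n).
      h * real (Suc i) / real (Suc (s n)) - h * real i / real (Suc (s n)) < e" if e: "0 < e" for e
  proof -
    have "(\<lambda>n. h * inverse (real (Suc n))) \<longlonglongrightarrow> h * 0"
      by (intro tendsto_mult tendsto_const LIMSEQ_inverse_real_of_nat)
    then have "(\<lambda>n. h / real (Suc (s n))) \<longlonglongrightarrow> 0"
      using LIMSEQ_subseq_LIMSEQ[OF _ assms(2), of "\<lambda>n. h * inverse (real (Suc n))" 0]
      by (simp add: comp_def divide_inverse)
    then have "\<forall>\<^sub>F n in sequentially. h / real (Suc (s n)) < e"
      using e by (rule order_tendstoD)
    then show ?thesis
      by eventually_elim (simp add: diff_divide_distrib[symmetric] right_diff_distrib[symmetric])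
  qed
  moreover have "h * real i / real (Suc k) \<le> h * real (Suc i) / real (Suc k)" for i k
    using assms(1) by (intro divide_right_mono mult_left_mono) auto
  moreover have "h * real (a * Suc k) / real (Suc k) = h * real a" for k
    by (simp only: of_nat_mult) (simp del: of_nat_Suc)
  ultimately show ?thesis
    unfolding vanishing_partitions_def by (intro conjI allI impI) (simp_all del: of_nat_Suc of_nat_mult mult_Suc_right)
qed

lemma vanishing_partitions_range:
  assumes "vanishing_partitions t N u" "i \<le> N n"
  shows "u n i \<in> {0..t}"
proof -
  have step: "u n j \<le> u n (Suc j)" if "j < N n" for j
    using assms(1) that unfolding vanishing_partitions_def by blast
  have "u n 0 \<le> u n i"
    using assms(2)
  proof (induction i)
    case (Suc i) then show ?case using step[of i] by simp
  qed simp
  moreover have "u n i \<le> u n (N n)"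
    using assms(2)
  proof (induction rule: inc_induct)
    case (step j) then show ?case using \<open>\<And>j. j < N n \<Longrightarrow> u n j \<le> u n (Suc j)\<close>[of j] by simp
  qed simp
  ultimately show ?thesis
    using assms(1) unfolding vanishing_partitions_def by simp
qed

text \<open>A continuous path is uniformly continuous on the compact interval
  \<open>{0..t}\<close>.\<close>

lemma vanishing_partitions_increments:
  fixes f :: "real \<Rightarrow> real"
  assumes part: "vanishing_partitions t N u" and f: "continuous_on {0..} f" and e: "0 < e"
  shows "\<forall>\<^sub>F n in sequentially. \<forall>i<N n. \<bar>f (u n (Suc i)) - f (u n i)\<bar> \<le> e"
proof -
  have "uniformly_continuous_on {0..t} f"
    using f by (intro compact_uniformly_continuous continuous_on_subset[OF f]) auto
  then obtain dl where dl: "0 < dl"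
    "\<And>a b. a \<in> {0..t} \<Longrightarrow> b \<in> {0..t} \<Longrightarrow> dist b a < dl \<Longrightarrow> dist (f b) (f a) < e"
    unfolding uniformly_continuous_on_def using e by blast
  have mesh: "\<forall>\<^sub>F n in sequentially. \<forall>i<N n. u n (Suc i) - u n i < dl"
    using part dl(1) unfolding vanishing_partitions_def by blast
  then show ?thesis
  proof eventually_elim
    case (elim n)
    show ?case
    proof (intro allI impI)
      fix i assume i: "i < N n"
      have "u n i \<le> u n (Suc i)"
        using part i unfolding vanishing_partitions_def by blast
      then have "dist (u n (Suc i)) (u n i) < dl"
        using elim i by (simp add: dist_real_def)
      then have "dist (f (u n (Suc i))) (f (u n i)) < e"
        using i by (intro dl(2) vanishing_partitions_range[OF part]) auto
      then show "\<bar>f (u n (Suc i)) - f (u n i)\<bar> \<le> e"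
        by (simp add: dist_real_def)
    qed
  qed
qed

section \<open>Second-order expansion of sums along partitions\<close>

text \<open>Uniformly small factors against factors of bounded absolute sum. It disposes both of
  products with increments of bounded variation and of cubic terms, where the squared increments
  have the bounded sum.\<close>

lemma tendsto_sum_mult_0:
  fixes a b :: "nat \<Rightarrow> nat \<Rightarrow> real"
  assumes a: "\<And>e. 0 < e \<Longrightarrow> \<forall>\<^sub>F n in sequentially. \<forall>i<N n. \<bar>a n i\<bar> \<le> e"
    and b: "\<forall>\<^sub>F n in sequentially. (\<Sum>i<N n. \<bar>b n i\<bar>) \<le> K"
  shows "(\<lambda>n. \<Sum>i<N n. a n i * b n i) \<longlonglongrightarrow> 0"
proof (rule tendstoI)
  fix e :: real assume e: "0 < e"
  \<comment> \<open>A strictly positive bound, so that it may appear in a denominator.\<close>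
  define K' where "K' = \<bar>K\<bar> + 1"
  have K': "K \<le> K'" "0 < K'" by (auto simp: K'_def)
  have "\<forall>\<^sub>F n in sequentially. \<forall>i<N n. \<bar>a n i\<bar> \<le> e / (2 * K')"
    using e K' by (intro a) simp
  with b show "\<forall>\<^sub>F n in sequentially. dist (\<Sum>i<N n. a n i * b n i) 0 < e"
  proof eventually_elim
    case (elim n)
    have "\<bar>\<Sum>i<N n. a n i * b n i\<bar> \<le> (\<Sum>i<N n. \<bar>a n i * b n i\<bar>)"
      by (rule sum_abs)
    also have "\<dots> \<le> (\<Sum>i<N n. e / (2 * K') * \<bar>b n i\<bar>)"
      using elim(2) by (intro sum_mono) (auto simp only: abs_mult lessThan_iff intro!: mult_right_mono)
    also have "\<dots> = e / (2 * K') * (\<Sum>i<N n. \<bar>b n i\<bar>)"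
      by (simp add: sum_distrib_left)
    also have "\<dots> \<le> e / (2 * K') * K'"
      using elim(1) K' e by (intro mult_left_mono) auto
    also have "\<dots> < e" using K' e by simp
    finally show ?case by (simp add: dist_real_def)
  qed
qed

text \<open>At a logarithmic increment \<open>x\<close>, this is the relative increment
  \<open>exp x - 1\<close> minus the logarithmic one.\<close>

definition exp_excess :: "real \<Rightarrow> real" where
  "exp_excess x = exp x - 1 - x"

lemma exp_excess_nonneg: "0 \<le> exp_excess x"
  using exp_ge_add_one_self[of x] unfolding exp_excess_def by linarith

text \<open>Taylor expansion to third order; the coefficient \<open>exp t / 6\<close> of the cube is
  at most 1 because \<open>exp 1 \<le> 3\<close>.\<close>

lemma exp_excess_approx:
  assumes "\<bar>x\<bar> \<le> 1"
  shows "\<bar>exp_excess x - x\<^sup>2 / 2\<bar> \<le> \<bar>x\<bar> * x\<^sup>2"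
proof -
  obtain t where t: "\<bar>t\<bar> \<le> \<bar>x\<bar>" "exp x = (\<Sum>m<3. x ^ m / fact m) + exp t / fact 3 * x ^ 3"
    using Maclaurin_exp_le[of x 3] by blast
  have eq: "exp_excess x - x\<^sup>2 / 2 = exp t / 6 * x ^ 3"
    using t(2) by (simp add: exp_excess_def eval_nat_numeral)
  have "exp t \<le> exp 1"
    using t(1) assms by simp
  also have "\<dots> \<le> 3" by (rule exp_le)
  finally have "\<bar>exp t / 6\<bar> \<le> 1" by simp
  then have "\<bar>exp t / 6\<bar> * \<bar>x ^ 3\<bar> \<le> 1 * \<bar>x ^ 3\<bar>"
    by (rule mult_right_mono) simp
  then have "\<bar>exp_excess x - x\<^sup>2 / 2\<bar> \<le> \<bar>x ^ 3\<bar>"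
    by (simp only: eq abs_mult mult_1_left)
  also have "\<bar>x ^ 3\<bar> = \<bar>x\<bar> * x\<^sup>2"
    by (simp add: power3_eq_cube power2_eq_square abs_mult)
  finally show ?thesis .
qed

text \<open>Paths that differ by bounded variation have the same quadratic variation, here
  \<open>q\<close>, and the excess is half the squared increment up to a cubic error.\<close>

lemma exp_excess_sum_tendsto:
  fixes x w :: "real \<Rightarrow> real"
  assumes part: "vanishing_partitions t N u"
    and x: "continuous_on {0..} x" and w: "continuous_on {0..} w"
    and bv: "\<And>n. (\<Sum>i<N n. \<bar>(x (u n (Suc i)) - w (u n (Suc i))) - (x (u n i) - w (u n i))\<bar>) \<le> K"
    and qv: "(\<lambda>n. \<Sum>i<N n. (w (u n (Suc i)) - w (u n i))\<^sup>2) \<longlonglongrightarrow> q"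
  shows "(\<lambda>n. \<Sum>i<N n. exp_excess (x (u n (Suc i)) - x (u n i))) \<longlonglongrightarrow> q / 2"
proof -
  define dx where "dx n i = x (u n (Suc i)) - x (u n i)" for n i
  define dw where "dw n i = w (u n (Suc i)) - w (u n i)" for n i
  have sm: "\<forall>\<^sub>F n in sequentially. \<forall>i<N n. \<bar>dx n i\<bar> \<le> e" if "0 < e" for e
    unfolding dx_def by (rule vanishing_partitions_increments[OF part x that])
  \<comment> \<open>The difference of the squares of \<open>dx\<close> and \<open>dw\<close> factors
    into \<open>dx + dw\<close>, uniformly small by continuity, and \<open>dx - dw\<close>, of
    absolute sum at most \<open>K\<close>.\<close>
  have "\<forall>\<^sub>F n in sequentially. \<forall>i<N n. \<bar>dx n i + dw n i\<bar> \<le> e" if "0 < e" for e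
    using vanishing_partitions_increments[OF part continuous_on_add[OF x w] that]
    by (simp add: dx_def dw_def algebra_simps)
  then have "(\<lambda>n. \<Sum>i<N n. (dx n i + dw n i) * (dx n i - dw n i)) \<longlonglongrightarrow> 0"
    by (rule tendsto_sum_mult_0[where K=K])
      (use bv in \<open>auto simp: dx_def dw_def algebra_simps\<close>)
  from tendsto_add[OF this qv] have qx: "(\<lambda>n. \<Sum>i<N n. (dx n i)\<^sup>2) \<longlonglongrightarrow> q"
    by (simp add: dw_def[symmetric] sum.distrib[symmetric] power2_eq_square algebra_simps)
  then have "\<forall>\<^sub>F n in sequentially. (\<Sum>i<N n. (dx n i)\<^sup>2) < q + 1"
    by (rule order_tendstoD) simp
  then have "\<forall>\<^sub>F n in sequentially. (\<Sum>i<N n. \<bar>(dx n i)\<^sup>2\<bar>) \<le> q + 1"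
    by eventually_elim simp
  then have cubic: "(\<lambda>n. \<Sum>i<N n. \<bar>dx n i\<bar> * (dx n i)\<^sup>2) \<longlonglongrightarrow> 0"
    using sm by (intro tendsto_sum_mult_0[where K="q + 1"]) auto
  have "(\<lambda>n. \<Sum>i<N n. exp_excess (dx n i) - (dx n i)\<^sup>2 / 2) \<longlonglongrightarrow> 0"
  proof (rule Lim_null_comparison[OF _ cubic])
    show "\<forall>\<^sub>F n in sequentially. norm (\<Sum>i<N n. exp_excess (dx n i) - (dx n i)\<^sup>2 / 2)
        \<le> (\<Sum>i<N n. \<bar>dx n i\<bar> * (dx n i)\<^sup>2)"
      using sm[OF zero_less_one]
      by eventually_elim (auto simp del: real_norm_def intro!: sum_norm_le simp: real_norm_def[of "_ - _"] exp_excess_approx)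
  qed
  from tendsto_add[OF this tendsto_divide[OF qx tendsto_const, of 2]] show ?thesis
    by (simp add: dx_def[symmetric] sum_subtractf sum_divide_distrib)
qed

text \<open>The ratio of consecutive values is the exponential of the logarithmic increment; the
  logarithmic increments telescope and the excesses remain.\<close>

lemma sum_relative_increments:
  fixes p :: "real \<Rightarrow> real"
  assumes "\<And>i. i \<le> n \<Longrightarrow> 0 < p (u i)"
  shows "(\<Sum>i<n. 1 / p (u i) * (p (u (Suc i)) - p (u i))) =
    ln (p (u n)) - ln (p (u 0)) + (\<Sum>i<n. exp_excess (ln (p (u (Suc i))) - ln (p (u i))))"
proof -
  have "(\<Sum>i<n. 1 / p (u i) * (p (u (Suc i)) - p (u i))) =
    (\<Sum>i<n. (ln (p (u (Suc i))) - ln (p (u i))) + exp_excess (ln (p (u (Suc i))) - ln (p (u i))))"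
  proof (rule sum.cong[OF refl])
    fix i assume "i \<in> {..<n}"
    then have "0 < p (u i)" "0 < p (u (Suc i))" using assms by auto
    then show "1 / p (u i) * (p (u (Suc i)) - p (u i)) =
        (ln (p (u (Suc i))) - ln (p (u i))) + exp_excess (ln (p (u (Suc i))) - ln (p (u i)))"
      by (simp add: exp_excess_def exp_diff field_simps)
  qed
  then show ?thesis
    by (simp add: sum.distrib sum_lessThan_telescope[of "\<lambda>i. ln (p (u i))"])
qed

section \<open>Quadratic variation of Brownian motion\<close>

text \<open>Independent centred variables are orthogonal, so only the diagonal of the double sum
  survives.\<close>

lemma (in prob_space) expectation_square_sum_indep:
  fixes Y :: "'i \<Rightarrow> 'a \<Rightarrow> real"
  assumes fin: "finite I" and ind: "indep_vars (\<lambda>_. borel) Y I"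
    and int: "\<And>i. i \<in> I \<Longrightarrow> integrable M (Y i)"
    and sq: "\<And>i. i \<in> I \<Longrightarrow> integrable M (\<lambda>\<omega>. (Y i \<omega>)\<^sup>2)"
    and zero: "\<And>i. i \<in> I \<Longrightarrow> expectation (Y i) = 0"
  shows "integrable M (\<lambda>\<omega>. (\<Sum>i\<in>I. Y i \<omega>)\<^sup>2)"
    and "expectation (\<lambda>\<omega>. (\<Sum>i\<in>I. Y i \<omega>)\<^sup>2) = (\<Sum>i\<in>I. expectation (\<lambda>\<omega>. (Y i \<omega>)\<^sup>2))"
proof -
  \<comment> \<open>The conditional form of the expectation lets the inner sum over \<open>j\<close>
    collapse to its term at \<open>i\<close>.\<close>
  have pair: "integrable M (\<lambda>\<omega>. Y i \<omega> * Y j \<omega>)"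
    "expectation (\<lambda>\<omega>. Y i \<omega> * Y j \<omega>) = (if j = i then expectation (\<lambda>\<omega>. (Y i \<omega>)\<^sup>2) else 0)"
    if ij: "i \<in> I" "j \<in> I" for i j
  proof -
    have *: "integrable M (\<lambda>\<omega>. Y i \<omega> * Y j \<omega>) \<and> expectation (\<lambda>\<omega>. Y i \<omega> * Y j \<omega>) = 0" if "j \<noteq> i"
    proof -
      have ind': "indep_vars (\<lambda>_. borel) Y {i, j}"
        using ind ij by (rule_tac indep_vars_subset) auto
      show ?thesis
        using indep_vars_integrable[OF _ ind'] indep_vars_lebesgue_integral[OF _ ind'] int ij that zero
        by auto
    qed
    show "integrable M (\<lambda>\<omega>. Y i \<omega> * Y j \<omega>)"
      using * sq[OF ij(1)] by (cases "j = i") (auto simp: power2_eq_square)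
    show "expectation (\<lambda>\<omega>. Y i \<omega> * Y j \<omega>) = (if j = i then expectation (\<lambda>\<omega>. (Y i \<omega>)\<^sup>2) else 0)"
      using * by (auto simp: power2_eq_square)
  qed
  have eq: "(\<Sum>i\<in>I. Y i \<omega>)\<^sup>2 = (\<Sum>i\<in>I. \<Sum>j\<in>I. Y i \<omega> * Y j \<omega>)" for \<omega>
    by (simp add: power2_eq_square sum_product)
  show "integrable M (\<lambda>\<omega>. (\<Sum>i\<in>I. Y i \<omega>)\<^sup>2)"
    unfolding eq using pair by (intro Bochner_Integration.integrable_sum) auto
  show "expectation (\<lambda>\<omega>. (\<Sum>i\<in>I. Y i \<omega>)\<^sup>2) = (\<Sum>i\<in>I. expectation (\<lambda>\<omega>. (Y i \<omega>)\<^sup>2))"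
    unfolding eq using pair fin
    by (simp add: Bochner_Integration.integral_sum Bochner_Integration.integrable_sum)
qed

text \<open>The second and fourth moments are \<open>h\<close> and \<open>3 * h\<^sup>2\<close>, so
  the variance of the square is \<open>3 * h\<^sup>2 - 2 * h\<^sup>2 + h\<^sup>2\<close>.\<close>

lemma normal_square_deviation:
  assumes "prob_space M" and h: "0 < h"
    and X: "distributed M lborel X (normal_density 0 (sqrt h))"
  shows "integrable M (\<lambda>\<omega>. (X \<omega>)\<^sup>2 - h)" "integral\<^sup>L M (\<lambda>\<omega>. (X \<omega>)\<^sup>2 - h) = 0"
    and "integrable M (\<lambda>\<omega>. ((X \<omega>)\<^sup>2 - h)\<^sup>2)" "integral\<^sup>L M (\<lambda>\<omega>. ((X \<omega>)\<^sup>2 - h)\<^sup>2) = 2 * h\<^sup>2"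
proof -
  interpret prob_space M by fact
  have sh: "0 < sqrt h" using h by simp
  have m2: "has_bochner_integral lborel (\<lambda>x. normal_density 0 (sqrt h) x * x ^ 2) h"
    using normal_moment_even[OF sh, of 0 1] h by simp
  have m4: "has_bochner_integral lborel (\<lambda>x. normal_density 0 (sqrt h) x * x ^ 4) (3 * h\<^sup>2)"
    using normal_moment_even[OF sh, of 0 2] h by (simp add: fact_numeral power_divide)
  have i2: "integrable M (\<lambda>\<omega>. X \<omega> ^ 2)" "expectation (\<lambda>\<omega>. X \<omega> ^ 2) = h"
    using distributed_integrable[OF X, of "\<lambda>x. x^2"] distributed_integral[OF X, of "\<lambda>x. x^2"] m2
    by (auto simp: has_bochner_integral_iff)
  have i4: "integrable M (\<lambda>\<omega>. X \<omega> ^ 4)" "expectation (\<lambda>\<omega>. X \<omega> ^ 4) = 3 * h\<^sup>2"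
    using distributed_integrable[OF X, of "\<lambda>x. x^4"] distributed_integral[OF X, of "\<lambda>x. x^4"] m4
    by (auto simp: has_bochner_integral_iff)
  show "integrable M (\<lambda>\<omega>. (X \<omega>)\<^sup>2 - h)" "integral\<^sup>L M (\<lambda>\<omega>. (X \<omega>)\<^sup>2 - h) = 0"
    using i2 by (auto simp: prob_space)
  have eq: "((X \<omega>)\<^sup>2 - h)\<^sup>2 = X \<omega> ^ 4 - 2 * h * X \<omega> ^ 2 + h\<^sup>2" for \<omega>
    by (simp add: power2_eq_square eval_nat_numeral algebra_simps)
  show "integrable M (\<lambda>\<omega>. ((X \<omega>)\<^sup>2 - h)\<^sup>2)" "integral\<^sup>L M (\<lambda>\<omega>. ((X \<omega>)\<^sup>2 - h)\<^sup>2) = 2 * h\<^sup>2"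
    unfolding eq using i2 i4 by (auto simp: prob_space power2_eq_square)
qed

text \<open>With \<open>n + 1\<close> equal cells the mean squared deviation from \<open>t\<close>
  is \<open>2 * t\<^sup>2 / (n + 1)\<close>, which tends to 0; a subsequence then converges almost
  surely.\<close>

lemma brownian_quadratic_variation_AE:
  assumes B: "standard_brownian_motion M B" and t: "0 < t"
  obtains s where "strict_mono s"
    "AE \<omega> in M. (\<lambda>n. \<Sum>i<Suc (s n). (B (t * real (Suc i) / real (Suc (s n))) \<omega> -
        B (t * real i / real (Suc (s n))) \<omega>)\<^sup>2) \<longlonglongrightarrow> t"
proof -
  interpret prob_space M using B by (simp add: standard_brownian_motion_def)
  define u where "u n i = t * real i / real (Suc n)" for n i :: nat
  define D where "D n i \<omega> = B (u n (Suc i)) \<omega> - B (u n i) \<omega>" for n i \<omega>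
  define h where "h n = t / real (Suc n)" for n
  have h: "0 < h n" for n using t by (simp add: h_def)
  have u: "0 \<le> u n i" "u n i < u n (Suc i)" "u n (Suc i) - u n i = h n" for n i
    using t by (simp_all add: u_def h_def divide_strict_right_mono
        diff_divide_distrib[symmetric] right_diff_distrib[symmetric])
  have dist: "distributed M lborel (D n i) (normal_density 0 (sqrt (h n)))" for n i
  proof -
    have "distributed M lborel (\<lambda>\<omega>. B (u n (Suc i)) \<omega> - B (u n i) \<omega>)
        (normal_density 0 (sqrt (u n (Suc i) - u n i)))"
      using B u(1,2) unfolding standard_brownian_motion_def by blast
    then show ?thesis by (simp only: u(3) D_def[abs_def])
  qed
  have "indep_vars (\<lambda>_. borel) (D n) {..<Suc n}" for n
    using B u(1,2) unfolding standard_brownian_motion_def D_def[abs_def] by blast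
  then have ind: "indep_vars (\<lambda>_. borel) (\<lambda>i \<omega>. (D n i \<omega>)\<^sup>2 - h n) {..<Suc n}" for n
    by (rule indep_vars_compose2) simp
  note dev = normal_square_deviation[OF prob_space_axioms h dist]
  \<comment> \<open>The cell lengths \<open>h n\<close> add up to \<open>t\<close>, so this is the
    squared deviation of the quadratic sum from \<open>t\<close>.\<close>
  define Q where "Q n \<omega> = (\<Sum>i<Suc n. (D n i \<omega>)\<^sup>2 - h n)\<^sup>2" for n \<omega>
  have Q_int: "integrable M (Q n)" for n
    unfolding Q_def[abs_def] by (rule expectation_square_sum_indep[OF _ ind]) (auto simp: dev)
  have "expectation (Q n) = (\<Sum>i<Suc n. 2 * (h n)\<^sup>2)" for n
    unfolding Q_def[abs_def] by (subst expectation_square_sum_indep[OF _ ind]) (auto simp: dev)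
  moreover have "(\<Sum>i<Suc n. 2 * (h n)\<^sup>2) = 2 * t\<^sup>2 * inverse (real (Suc n))" for n
    by (simp add: h_def power2_eq_square field_simps del: of_nat_Suc sum.lessThan_Suc)
  moreover have "norm (Q n \<omega>) = Q n \<omega>" for n \<omega>
    by (simp add: Q_def)
  ultimately have "expectation (\<lambda>\<omega>. norm (Q n \<omega>)) = 2 * t\<^sup>2 * inverse (real (Suc n))" for n
    by simp
  moreover have "(\<lambda>n. 2 * t\<^sup>2 * inverse (real (Suc n))) \<longlonglongrightarrow> 2 * t\<^sup>2 * 0"
    by (intro tendsto_mult tendsto_const LIMSEQ_inverse_real_of_nat)
  ultimately have "(\<lambda>n. expectation (\<lambda>\<omega>. norm (Q n \<omega>))) \<longlonglongrightarrow> 0"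
    by simp
  from tendsto_L1_AE_subseq[OF Q_int this] obtain s
    where s: "strict_mono s" "AE \<omega> in M. (\<lambda>n. Q (s n) \<omega>) \<longlonglongrightarrow> 0"
    by auto
  have "AE \<omega> in M. (\<lambda>n. \<Sum>i<Suc (s n). (D (s n) i \<omega>)\<^sup>2) \<longlonglongrightarrow> t"
    using s(2)
  proof eventually_elim
    case (elim \<omega>)
    have "(\<Sum>i<Suc k. (D k i \<omega>)\<^sup>2 - h k) = (\<Sum>i<Suc k. (D k i \<omega>)\<^sup>2) - t" for k
      by (simp add: sum_subtractf h_def del: sum.lessThan_Suc of_nat_Suc)
    then have "(\<lambda>n. ((\<Sum>i<Suc (s n). (D (s n) i \<omega>)\<^sup>2) - t)\<^sup>2) \<longlonglongrightarrow> 0"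
      using elim by (simp add: Q_def del: sum.lessThan_Suc)
    from tendsto_real_sqrt[OF this] show ?case
      by (simp add: tendsto_rabs_zero_iff LIM_zero_iff del: sum.lessThan_Suc)
  qed
  with s(1) show ?thesis
    unfolding D_def u_def by (rule that)
qed

section \<open>Identification of the price process\<close>

text \<open>The time is fixed here. The Ito sums converge in probability, so pathwise limits are
  taken along subsequences, extracted one after another so that all of them hold along a common
  one.\<close>

lemma price_process_AE_eq:
  assumes B: "standard_brownian_motion M B"
    and P: "price_process M B p0 g \<sigma> P"
    and p0: "0 < p0" and t: "0 < t"
  shows "AE \<omega> in M. P t \<omega> = p0 * exp ((g - \<sigma>\<^sup>2 / 2) * t + \<sigma> * B t \<omega>)"
proof -
  interpret prob_space M using B by (simp add: standard_brownian_motion_def)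
  have B_meas [measurable]: "B t \<in> borel_measurable M" if "0 \<le> t" for t
    using B that by (simp add: standard_brownian_motion_def)
  have P_meas [measurable]: "P t \<in> borel_measurable M" if "0 \<le> t" for t
    using P that by (simp add: price_process_def)
  have P_pos: "0 < P t \<omega>" if "\<omega> \<in> space M" "0 \<le> t" for t \<omega>
    using P that by (simp add: price_process_def)
  have P0: "P 0 \<omega> = p0" and B0: "B 0 \<omega> = 0" if "\<omega> \<in> space M" for \<omega>
    using B P that by (simp_all add: standard_brownian_motion_def price_process_def)
  define x where "x t \<omega> = ln (P t \<omega>)" for t \<omega>
  define A where "A t \<omega> = g * t + \<sigma> * B t \<omega> - (x t \<omega> - ln p0)" for t \<omega>
  have x0: "x 0 \<omega> = ln p0" if "\<omega> \<in> space M" for \<omega>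
    using P0[OF that] by (simp add: x_def)
  have x_cont: "continuous_on {0..} (\<lambda>t. x t \<omega>)" if "\<omega> \<in> space M" for \<omega>
    using P that P_pos[OF that] unfolding x_def price_process_def
    by (intro continuous_on_ln) (auto simp: less_imp_neq[symmetric])
  have B_cont: "continuous_on {0..} (\<lambda>t. B t \<omega>)" if "\<omega> \<in> space M" for \<omega>
    using B that by (simp add: standard_brownian_motion_def)
  define E where "E u n \<omega> = (\<Sum>i<n. exp_excess (x (u (Suc i)) \<omega> - x (u i) \<omega>))" for u n \<omega>

  \<comment> \<open>Stated for arbitrary partitions, because it is also applied to sequences that
    have already been thinned out.\<close>
  have excess: "\<exists>s'. strict_mono s' \<and> (AE \<omega> in M. (\<lambda>n. E (u (s' n)) (N (s' n)) \<omega>) \<longlonglongrightarrow> A t \<omega>)"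
    if part: "vanishing_partitions t N u" for t N u
  proof -
    note range = vanishing_partitions_range[OF part]
    have t: "0 \<le> t" and ends: "u n 0 = 0" "u n (N n) = t" for n
      using range[of 0] part by (auto simp: vanishing_partitions_def)
    define S where "S n \<omega> = (\<Sum>i<N n. 1 / P (u n i) \<omega> * (P (u n (Suc i)) \<omega> - P (u n i) \<omega>))" for n \<omega>
    have "P (u n i) \<in> borel_measurable M" if "i \<le> N n" for n i
      using range[OF that] by (intro P_meas) auto
    then have S_meas: "S n \<in> borel_measurable M" for n
      unfolding S_def[abs_def]
      by (intro borel_measurable_sum borel_measurable_times borel_measurable_diff
          borel_measurable_divide borel_measurable_const) auto
    have Z_meas: "(\<lambda>\<omega>. g * t + \<sigma> * B t \<omega>) \<in> borel_measurable M"
      using t by measurable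
    have "tendsto_in_probability M S (\<lambda>\<omega>. g * t + \<sigma> * B t \<omega>)"
      using P part t unfolding price_process_def has_ito_integral_def S_def[abs_def] by blast
    from tendsto_in_probability_AE_subseq[OF prob_space_axioms S_meas Z_meas this]
    obtain s' where s': "strict_mono s'"
      "AE \<omega> in M. (\<lambda>n. S (s' n) \<omega>) \<longlonglongrightarrow> g * t + \<sigma> * B t \<omega>" .
    have S_eq: "S n \<omega> - (x t \<omega> - ln p0) = E (u n) (N n) \<omega>" if "\<omega> \<in> space M" for n \<omega>
    proof -
      have "S n \<omega> = x (u n (N n)) \<omega> - x (u n 0) \<omega> + E (u n) (N n) \<omega>"
        unfolding S_def E_def x_def
        using range by (intro sum_relative_increments P_pos[OF that]) auto
      then show ?thesis by (simp add: ends x0[OF that])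
    qed
    have "AE \<omega> in M. (\<lambda>n. E (u (s' n)) (N (s' n)) \<omega>) \<longlonglongrightarrow> A t \<omega>"
      using s'(2) AE_space
    proof eventually_elim
      case (elim \<omega>)
      have "(\<lambda>n. S (s' n) \<omega> - (x t \<omega> - ln p0)) \<longlonglongrightarrow> A t \<omega>"
        unfolding A_def by (intro tendsto_diff elim(1) tendsto_const)
      then show ?case by (simp only: S_eq[OF elim(2)])
    qed
    with s'(1) show ?thesis by blast
  qed

  \<comment> \<open>Along a common subsequence both sides are limits of sums of nonnegative terms
    over nested grids, the sum up to \<open>h * a\<close> being part of the sum up to
    \<open>h * b\<close>.\<close>
  have mono: "AE \<omega> in M. A (h * real a) \<omega> \<le> A (h * real b) \<omega>"
    if h: "0 \<le> h" and ab: "a \<le> b" for h a b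
  proof -
    obtain s where s: "strict_mono s"
      "AE \<omega> in M. (\<lambda>n. E (\<lambda>i. h * real i / real (Suc (s n))) (a * Suc (s n)) \<omega>) \<longlonglongrightarrow> A (h * real a) \<omega>"
      using excess[OF vanishing_partitions_grid[OF h strict_mono_id, of a]] by auto
    obtain s' where s': "strict_mono s'"
      "AE \<omega> in M. (\<lambda>n. E (\<lambda>i. h * real i / real (Suc (s (s' n)))) (b * Suc (s (s' n))) \<omega>)
         \<longlonglongrightarrow> A (h * real b) \<omega>"
      using excess[OF vanishing_partitions_grid[OF h s(1), of b]] by auto
    from s(2) s'(2) show ?thesis
    proof eventually_elim
      case (elim \<omega>)
      from LIMSEQ_subseq_LIMSEQ[OF elim(1) s'(1)] elim(2)
      show ?case
      proof (rule LIMSEQ_le, intro exI allI impI)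
        fix n
        show "((\<lambda>n. E (\<lambda>i. h * real i / real (Suc (s n))) (a * Suc (s n)) \<omega>) \<circ> s') n
          \<le> E (\<lambda>i. h * real i / real (Suc (s (s' n)))) (b * Suc (s (s' n))) \<omega>"
          unfolding E_def comp_def using ab
          by (intro sum_mono2) (auto simp: exp_excess_nonneg simp del: mult_Suc_right
              intro: less_le_trans mult_le_mono1)
      qed
    qed
  qed

  obtain s where s: "strict_mono s"
    "AE \<omega> in M. (\<lambda>n. \<Sum>i<Suc (s n). (B (t * real (Suc i) / real (Suc (s n))) \<omega> -
        B (t * real i / real (Suc (s n))) \<omega>)\<^sup>2) \<longlonglongrightarrow> t"
    by (rule brownian_quadratic_variation_AE[OF B t])
  define u where "u n i = t * real i / real (Suc (s n))" for n i
  have part: "vanishing_partitions t (\<lambda>n. Suc (s n)) u"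
    using vanishing_partitions_grid[OF less_imp_le[OF t] s(1), of 1] by (simp add: u_def[abs_def])
  obtain s' where s': "strict_mono s'"
    "AE \<omega> in M. (\<lambda>n. E (u (s' n)) (Suc (s (s' n))) \<omega>) \<longlonglongrightarrow> A t \<omega>"
    using excess[OF part] by auto
  \<comment> \<open>Taking one cell as the coarse step compares consecutive grid points. There are
    countably many, so a single null set serves for all of them.\<close>
  have "AE \<omega> in M. A (t / real (Suc (s n)) * real i) \<omega> \<le> A (t / real (Suc (s n)) * real (Suc i)) \<omega>" for n i
    using t by (intro mono) auto
  then have A_mono: "AE \<omega> in M. \<forall>n i. A (u n i) \<omega> \<le> A (u n (Suc i)) \<omega>"
    by (simp add: AE_all_countable u_def del: of_nat_Suc)
  from s(2) s'(2) A_mono AE_space show ?thesis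
  proof eventually_elim
    case (elim \<omega>)
    have ends: "u n 0 = 0" "u n (Suc (s n)) = t" for n
      using part by (auto simp: vanishing_partitions_def)
    have u_mono: "u n i \<le> u n (Suc i)" for n i
      using t by (simp add: u_def divide_right_mono)
    have x_eq: "x r \<omega> - \<sigma> * B r \<omega> = g * r - A r \<omega> + ln p0" for r
      by (simp add: A_def)
    \<comment> \<open>Each increment of \<open>g * r - A r\<close> is bounded by that of the
      increasing function \<open>\<bar>g\<bar> * r + A r\<close> on the grid, and the latter
      telescopes.\<close>
    have bv: "(\<Sum>i<Suc (s n). \<bar>(x (u n (Suc i)) \<omega> - \<sigma> * B (u n (Suc i)) \<omega>)
        - (x (u n i) \<omega> - \<sigma> * B (u n i) \<omega>)\<bar>) \<le> \<bar>g\<bar> * t + A t \<omega>" for n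
    proof -
      have "\<bar>(x (u n (Suc i)) \<omega> - \<sigma> * B (u n (Suc i)) \<omega>) - (x (u n i) \<omega> - \<sigma> * B (u n i) \<omega>)\<bar>
          \<le> (\<bar>g\<bar> * u n (Suc i) + A (u n (Suc i)) \<omega>) - (\<bar>g\<bar> * u n i + A (u n i) \<omega>)" for i
      proof -
        have "\<bar>g * (u n (Suc i) - u n i)\<bar> = \<bar>g\<bar> * (u n (Suc i) - u n i)"
          using u_mono[of n i] by (simp add: abs_mult)
        moreover have "A (u n i) \<omega> \<le> A (u n (Suc i)) \<omega>"
          using elim(3) by blast
        ultimately show ?thesis
          unfolding x_eq by (simp add: algebra_simps abs_le_iff)
      qed
      then have "(\<Sum>i<Suc (s n). \<bar>(x (u n (Suc i)) \<omega> - \<sigma> * B (u n (Suc i)) \<omega>)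
          - (x (u n i) \<omega> - \<sigma> * B (u n i) \<omega>)\<bar>)
        \<le> (\<Sum>i<Suc (s n). (\<bar>g\<bar> * u n (Suc i) + A (u n (Suc i)) \<omega>) - (\<bar>g\<bar> * u n i + A (u n i) \<omega>))"
        by (intro sum_mono)
      also have "\<dots> = \<bar>g\<bar> * t + A t \<omega> - A 0 \<omega>"
        by (subst sum_lessThan_telescope) (simp add: ends)
      also have "A 0 \<omega> = 0"
        using elim(4) by (simp add: A_def x0 B0)
      finally show ?thesis by simp
    qed
    have "(\<lambda>n. \<sigma>\<^sup>2 * (\<Sum>i<Suc (s n). (B (u n (Suc i)) \<omega> - B (u n i) \<omega>)\<^sup>2)) \<longlonglongrightarrow> \<sigma>\<^sup>2 * t"
      using elim(1) unfolding u_def by (intro tendsto_mult tendsto_const)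
    then have qv: "(\<lambda>n. \<Sum>i<Suc (s n). (\<sigma> * B (u n (Suc i)) \<omega> - \<sigma> * B (u n i) \<omega>)\<^sup>2) \<longlonglongrightarrow> \<sigma>\<^sup>2 * t"
      by (simp add: sum_distrib_left power_mult_distrib[symmetric] right_diff_distrib
          del: sum.lessThan_Suc)
    have "(\<lambda>n. E (u n) (Suc (s n)) \<omega>) \<longlonglongrightarrow> \<sigma>\<^sup>2 * t / 2"
      unfolding E_def
      by (rule exp_excess_sum_tendsto[OF part x_cont[OF elim(4)] _ bv qv])
        (intro continuous_intros B_cont[OF elim(4)])
    \<comment> \<open>The same excess sums tend to \<open>A t\<close> along \<open>s'\<close> and to
      half the quadratic variation, so the two limits agree.\<close>
    from LIMSEQ_unique[OF elim(2) LIMSEQ_subseq_LIMSEQ[OF this s'(1), unfolded comp_def]]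
    have "A t \<omega> = \<sigma>\<^sup>2 * t / 2" .
    then have "ln (P t \<omega>) = ln p0 + ((g - \<sigma>\<^sup>2 / 2) * t + \<sigma> * B t \<omega>)"
      by (simp add: A_def x_def algebra_simps)
    then have "exp (ln (P t \<omega>)) = exp (ln p0) * exp ((g - \<sigma>\<^sup>2 / 2) * t + \<sigma> * B t \<omega>)"
      by (simp only: exp_add)
    then show ?case
      using P_pos[OF elim(4), of t] p0 t by simp
  qed
qed

text \<open>The null set for a fixed time depends on that time. Rational times share one null set
  and path continuity extends the formula to all times, as evaluation at a random time
  requires.\<close>

lemma price_process_AE_eq_all:
  assumes B: "standard_brownian_motion M B"
    and P: "price_process M B p0 g \<sigma> P"
    and p0: "0 < p0"
  shows "AE \<omega> in M. \<forall>t\<ge>0. P t \<omega> = p0 * exp ((g - \<sigma>\<^sup>2 / 2) * t + \<sigma> * B t \<omega>)"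
proof -
  have "AE \<omega> in M. \<forall>q::rat. 0 < q \<longrightarrow>
      P (of_rat q) \<omega> = p0 * exp ((g - \<sigma>\<^sup>2 / 2) * of_rat q + \<sigma> * B (of_rat q) \<omega>)"
    unfolding AE_all_countable
    using price_process_AE_eq[OF B P p0] by (auto simp: zero_less_of_rat_iff)
  with AE_space show ?thesis
  proof eventually_elim
    case (elim \<omega>)
    define F where "F t = P t \<omega> - p0 * exp ((g - \<sigma>\<^sup>2 / 2) * t + \<sigma> * B t \<omega>)" for t
    have "continuous_on {0..} (\<lambda>t. P t \<omega>)" "continuous_on {0..} (\<lambda>t. B t \<omega>)"
      using B P elim(1) by (simp_all add: standard_brownian_motion_def price_process_def)
    then have F: "continuous_on {0..} F"
      unfolding F_def by (intro continuous_intros)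
    have Q0: "F q = 0" if "q \<in> \<rat>" "0 < q" for q
      using that elim(2) by (auto simp: F_def Rats_def)
    have "F t = 0" if t: "0 \<le> t" for t
    proof (rule ccontr)
      assume "F t \<noteq> 0"
      then obtain dl where dl: "0 < dl" "\<And>r. 0 \<le> r \<Longrightarrow> dist r t < dl \<Longrightarrow> dist (F r) (F t) < \<bar>F t\<bar>"
        using F t unfolding continuous_on_iff by (metis atLeast_iff zero_less_abs_iff)
      \<comment> \<open>Choosing \<open>q\<close> to the right of \<open>t\<close> keeps it positive
        even for \<open>t = 0\<close>.\<close>
      obtain q where q: "q \<in> \<rat>" "t < q" "q < t + dl"
        using Rats_dense_in_real[of t "t + dl"] dl(1) by auto
      have "dist (F q) (F t) < \<bar>F t\<bar>"
        using q t by (intro dl(2)) (auto simp: dist_real_def)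
      then show False
        using Q0[of q] q t by (simp add: dist_real_def)
    qed
    then show ?case by (simp add: F_def)
  qed
qed

section \<open>Positivity of the normal law and hitting times of a line\<close>

text \<open>The density is positive everywhere, so a null set of the law is Lebesgue null, which a
  nonempty open interval is not.\<close>

lemma normal_prob_interval_pos:
  assumes "prob_space M" and h: "0 < h"
    and X: "distributed M lborel X (normal_density 0 (sqrt h))" and ab: "a < b"
  shows "\<not> (AE \<omega> in M. X \<omega> \<notin> {a<..<b})"
proof
  interpret prob_space M by fact
  assume "AE \<omega> in M. X \<omega> \<notin> {a<..<b}"
  moreover have [measurable]: "X \<in> borel_measurable M"
    using distributed_measurable[OF X] by simp
  ultimately have "AE x in distr M lborel X. x \<notin> {a<..<b}"
    by (subst AE_distr_iff) auto
  then have "AE x in density lborel (normal_density 0 (sqrt h)). x \<notin> {a<..<b}"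
    by (simp only: distributed_distr_eq_density[OF X])
  then have "AE x in lborel. x \<notin> {a<..<b}"
    using h by (simp add: AE_density normal_density_pos)
  then have "emeasure lborel {a<..<b} = 0"
    by (subst (asm) AE_iff_measurable[of "{a<..<b}"]) auto
  then show False using ab by simp
qed

lemma hitting_time_eq_infinity_iff:
  "hitting_time B c d \<omega> = \<infinity> \<longleftrightarrow> (\<forall>t\<ge>0. B t \<omega> \<noteq> c + d * t)"
  unfolding hitting_time_def by (auto simp: Inf_eq_PInfty)

text \<open>By continuity the set of hitting times is closed, so it contains its infimum.\<close>

lemma hitting_time_attained:
  assumes cont: "continuous_on {0..} (\<lambda>t. B t \<omega>)" and fin: "hitting_time B c d \<omega> \<noteq> \<infinity>"
  obtains \<tau> where "hitting_time B c d \<omega> = ereal \<tau>" "0 \<le> \<tau>" "B \<tau> \<omega> = c + d * \<tau>"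
    "\<forall>t. 0 \<le> t \<longrightarrow> B t \<omega> = c + d * t \<longrightarrow> \<tau> \<le> t"
proof -
  define S where "S = {t. 0 \<le> t \<and> B t \<omega> = c + d * t}"
  have S: "S \<noteq> {}" "bdd_below S"
    using fin by (auto simp: S_def hitting_time_eq_infinity_iff intro: bdd_belowI[of _ 0])
  have "S = {t \<in> {0..}. B t \<omega> - (c + d * t) = 0}" by (auto simp: S_def)
  moreover have "closed \<dots>"
    by (intro continuous_closed_preimage_constant continuous_intros cont closed_atLeast)
  ultimately have "Inf S \<in> S"
    using S by (metis closed_contains_Inf)
  moreover have lower: "Inf S \<le> t" if "t \<in> S" for t
    using that S(2) by (rule cInf_lower)
  moreover have "hitting_time B c d \<omega> = ereal (Inf S)"
    unfolding hitting_time_def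
  proof (rule antisym)
    show "Inf {ereal t |t. 0 \<le> t \<and> B t \<omega> = c + d * t} \<le> ereal (Inf S)"
      using \<open>Inf S \<in> S\<close> by (intro Inf_lower) (auto simp: S_def)
    show "ereal (Inf S) \<le> Inf {ereal t |t. 0 \<le> t \<and> B t \<omega> = c + d * t}"
      using lower by (intro Inf_greatest) (auto simp: S_def)
  qed
  ultimately show ?thesis
    by (intro that[of "Inf S"]) (auto simp: S_def)
qed

text \<open>Expresses the event through countably many times. A hit is approached at nearby rational
  times; conversely, the distance to the line attains its minimum on the compact interval
  \<open>{0..t}\<close>, and that minimum is 0.\<close>

lemma hitting_time_le_iff:
  assumes cont: "continuous_on {0..} (\<lambda>t. B t \<omega>)" and t: "0 < t"
  shows "hitting_time B c d \<omega> \<le> ereal t \<longleftrightarrow>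
    (\<forall>n. \<exists>q::rat. 0 < q \<and> of_rat q < t \<and> \<bar>B (of_rat q) \<omega> - (c + d * of_rat q)\<bar> < 1 / real (Suc n))"
    (is "?L \<longleftrightarrow> ?R")
proof -
  define F where "F t = \<bar>B t \<omega> - (c + d * t)\<bar>" for t
  have F: "continuous_on {0..} F"
    unfolding F_def by (intro continuous_intros cont)
  show ?thesis
  proof
    assume ?L
    then have "hitting_time B c d \<omega> \<noteq> \<infinity>" by auto
    with cont obtain \<tau> where \<tau>: "hitting_time B c d \<omega> = ereal \<tau>" "0 \<le> \<tau>" "B \<tau> \<omega> = c + d * \<tau>"
      by (rule hitting_time_attained)
    have \<tau>t: "\<tau> \<le> t" using \<open>?L\<close> \<tau>(1) by simp
    show ?R
    proof
      fix n
      obtain e where e: "0 < e" "\<And>r. 0 \<le> r \<Longrightarrow> dist r \<tau> < e \<Longrightarrow> dist (F r) (F \<tau>) < 1 / real (Suc n)"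
        using F[unfolded continuous_on_iff, rule_format, of \<tau> "1 / real (Suc n)"] \<tau>(2) by auto
      \<comment> \<open>The window around \<open>\<tau>\<close>, clipped to the open interval from 0
        to \<open>t\<close>, is nonempty even if \<open>\<tau>\<close> is an endpoint.\<close>
      have "max 0 (\<tau> - e) < min t (\<tau> + e)"
        using e(1) t \<tau>(2) \<tau>t by auto
      then obtain q where q: "q \<in> \<rat>" "max 0 (\<tau> - e) < q" "q < min t (\<tau> + e)"
        using Rats_dense_in_real by blast
      then have "dist (F q) (F \<tau>) < 1 / real (Suc n)"
        by (intro e(2)) (auto simp: dist_real_def)
      then have "F q < 1 / real (Suc n)"
        using \<tau>(3) by (simp add: F_def dist_real_def)
      moreover obtain q' where "q = of_rat q'"
        using q(1) by (auto simp: Rats_def)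
      ultimately show "\<exists>q::rat. 0 < q \<and> of_rat q < t \<and>
          \<bar>B (of_rat q) \<omega> - (c + d * of_rat q)\<bar> < 1 / real (Suc n)"
        using q(2,3) by (intro exI[of _ q']) (auto simp: F_def)
    qed
  next
    assume R: ?R
    obtain \<tau> where \<tau>: "\<tau> \<in> {0..t}" "\<And>r. r \<in> {0..t} \<Longrightarrow> F \<tau> \<le> F r"
      using continuous_attains_inf[of "{0..t}" F] continuous_on_subset[OF F, of "{0..t}"] t by auto
    have "F \<tau> \<le> 1 / real (Suc n)" for n
    proof -
      obtain q :: rat where q: "0 < q" "of_rat q < t" "F (of_rat q) < 1 / real (Suc n)"
        using R by (auto simp: F_def)
      then have "F \<tau> \<le> F (of_rat q)" by (intro \<tau>(2)) auto
      with q(3) show ?thesis by simp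
    qed
    moreover have "(\<lambda>n. 1 / real (Suc n)) \<longlonglongrightarrow> 0"
      using LIMSEQ_inverse_real_of_nat by (simp add: inverse_eq_divide)
    ultimately have "F \<tau> \<le> 0"
      by (intro LIMSEQ_le_const) auto
    then have "B \<tau> \<omega> = c + d * \<tau>" by (simp add: F_def)
    then have "hitting_time B c d \<omega> \<le> ereal \<tau>"
      unfolding hitting_time_def using \<tau>(1) by (intro Inf_lower) auto
    also have "\<dots> \<le> ereal t" using \<tau>(1) by simp
    finally show ?L .
  qed
qed

lemma hitting_time_nonneg: "0 \<le> hitting_time B c d \<omega>"
  unfolding hitting_time_def by (intro Inf_greatest) auto

lemma hitting_time_measurable:
  assumes meas: "\<And>t. 0 \<le> t \<Longrightarrow> B t \<in> borel_measurable M"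
    and cont: "\<And>\<omega>. \<omega> \<in> space M \<Longrightarrow> continuous_on {0..} (\<lambda>t. B t \<omega>)"
  shows "hitting_time B c d \<in> borel_measurable M"
proof (rule borel_measurableI_greater)
  fix y :: ereal
  have le_meas: "{\<omega> \<in> space M. hitting_time B c d \<omega> \<le> ereal t} \<in> sets M" if t: "0 < t" for t
  proof -
    have "{\<omega> \<in> space M. hitting_time B c d \<omega> \<le> ereal t} = {\<omega> \<in> space M. \<forall>n. \<exists>q\<in>{q::rat. 0 < q}.
        of_rat q < t \<and> \<bar>B (of_rat q) \<omega> - (c + d * of_rat q)\<bar> < 1 / real (Suc n)}"
      using hitting_time_le_iff[where B=B, OF cont t] by auto
    also have "\<dots> \<in> sets M"
    proof (intro sets.sets_Collect_countable_All sets.sets_Collect_countable_Ex')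
      fix n and q :: rat assume "q \<in> {q. 0 < q}"
      then have [measurable]: "(\<lambda>\<omega>. B (of_rat q) \<omega>) \<in> borel_measurable M"
        by (intro meas) simp
      show "{\<omega> \<in> space M. of_rat q < t \<and> \<bar>B (of_rat q) \<omega> - (c + d * of_rat q)\<bar> < 1 / real (Suc n)} \<in> sets M"
        by measurable
    qed auto
    finally show ?thesis .
  qed
  show "{\<omega> \<in> space M. y < hitting_time B c d \<omega>} \<in> sets M"
  proof (cases "y < 0")
    case True
    then have "y < hitting_time B c d \<omega>" for \<omega>
      using hitting_time_nonneg by (rule less_le_trans)
    then show ?thesis by simp
  next
    case False
    \<comment> \<open>For \<open>y \<ge> 0\<close> the rational thresholds above \<open>y\<close>
      are positive, as \<open>le_meas\<close> demands.\<close>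
    then have "{\<omega> \<in> space M. y < hitting_time B c d \<omega>} =
        space M \<inter> (\<Union>q\<in>{q::rat. y < ereal (of_rat q)}. space M - {\<omega> \<in> space M. hitting_time B c d \<omega> \<le> ereal (of_rat q)})"
    proof (safe, goal_cases)
      case (1 \<omega>)
      \<comment> \<open>Two real levels are interposed because the hitting time may be infinite; a
        rational is then found between these reals.\<close>
      then obtain z where z: "y < ereal z" "ereal z < hitting_time B c d \<omega>"
        using ereal_dense2 by blast
      then obtain z' where z': "ereal z < ereal z'" "ereal z' < hitting_time B c d \<omega>"
        using ereal_dense2 by blast
      then obtain q where q: "q \<in> \<rat>" "z < q" "q < z'"
        using Rats_dense_in_real by auto
      then obtain q' where q': "q = of_rat q'" by (auto simp: Rats_def)
      have "y < ereal q" using less_trans[OF z(1), of "ereal q"] q(2) by simp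
      moreover have "ereal q < hitting_time B c d \<omega>"
        using less_trans[OF _ z'(2), of "ereal q"] q(3) by simp
      ultimately show ?case using q' 1 by (auto simp: not_le)
    qed (auto simp: not_le)
    also have "\<dots> \<in> sets M"
    proof (intro sets.Int sets.top sets.countable_UN'' sets.Diff le_meas)
      fix q :: rat assume "q \<in> {q. y < ereal (of_rat q)}"
      with False have "0 < ereal (of_rat q)"
        using le_less_trans[of 0 y "ereal (of_rat q)"] by simp
      then show "0 < (of_rat q :: real)" by simp
    qed auto
    finally show ?thesis .
  qed
qed

text \<open>Rounding the random time down to a multiple of \<open>1 / Suc n\<close> leaves countably
  many values, hence a measurable evaluation; continuity of the paths gives the limit.\<close>

lemma process_at_random_time_measurable:
  fixes P :: "real \<Rightarrow> 'a \<Rightarrow> real"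
  assumes meas: "\<And>t. 0 \<le> t \<Longrightarrow> P t \<in> borel_measurable M"
    and cont: "\<And>\<omega>. \<omega> \<in> space M \<Longrightarrow> continuous_on {0..} (\<lambda>t. P t \<omega>)"
    and \<tau> [measurable]: "\<tau> \<in> borel_measurable M" and nonneg: "\<And>\<omega>. \<omega> \<in> space M \<Longrightarrow> 0 \<le> \<tau> \<omega>"
  shows "(\<lambda>\<omega>. P (\<tau> \<omega>) \<omega>) \<in> borel_measurable M"
proof -
  define k where "k n \<omega> = nat \<lfloor>real (Suc n) * \<tau> \<omega>\<rfloor>" for n \<omega>
  have "(\<lambda>\<omega>. P (real (k n \<omega>) / real (Suc n)) \<omega>) \<in> borel_measurable M" for n
  proof (rule measurable_compose_countable[where g="k n"])
    show "P (real i / real (Suc n)) \<in> borel_measurable M" for i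
      by (rule meas) simp
    show "k n \<in> measurable M (count_space UNIV)"
      unfolding k_def[abs_def] by measurable
  qed
  moreover have "(\<lambda>n. P (real (k n \<omega>) / real (Suc n)) \<omega>) \<longlonglongrightarrow> P (\<tau> \<omega>) \<omega>" if \<omega>: "\<omega> \<in> space M" for \<omega>
  proof (rule continuous_on_tendsto_compose[OF cont[OF \<omega>]])
    have k: "real (Suc n) * \<tau> \<omega> - 1 \<le> real (k n \<omega>)" "real (k n \<omega>) \<le> real (Suc n) * \<tau> \<omega>" for n
    proof -
      have "0 \<le> real (Suc n) * \<tau> \<omega>" using nonneg[OF \<omega>] by simp
      then have "real (k n \<omega>) = real_of_int \<lfloor>real (Suc n) * \<tau> \<omega>\<rfloor>"
        unfolding k_def by (simp del: of_nat_Suc)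
      then show "real (Suc n) * \<tau> \<omega> - 1 \<le> real (k n \<omega>)" "real (k n \<omega>) \<le> real (Suc n) * \<tau> \<omega>"
        by linarith+
    qed
    have lower: "\<tau> \<omega> - inverse (real (Suc n)) \<le> real (k n \<omega>) / real (Suc n)" for n
      using divide_right_mono[OF k(1)[of n], of "real (Suc n)"]
      by (simp add: diff_divide_distrib inverse_eq_divide del: of_nat_Suc)
    have upper: "real (k n \<omega>) / real (Suc n) \<le> \<tau> \<omega>" for n
      using divide_right_mono[OF k(2)[of n], of "real (Suc n)"] by (simp del: of_nat_Suc)
    have "(\<lambda>n. \<tau> \<omega> - inverse (real (Suc n))) \<longlonglongrightarrow> \<tau> \<omega> - 0"
      by (intro tendsto_diff tendsto_const LIMSEQ_inverse_real_of_nat)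
    then have "(\<lambda>n. \<tau> \<omega> - inverse (real (Suc n))) \<longlonglongrightarrow> \<tau> \<omega>"
      by simp
    with always_eventually[OF allI, OF lower] always_eventually[OF allI, OF upper]
    show "(\<lambda>n. real (k n \<omega>) / real (Suc n)) \<longlonglongrightarrow> \<tau> \<omega>"
      by (rule tendsto_sandwich[OF _ _ _ tendsto_const])
  qed (simp_all add: nonneg[OF \<omega>])
  ultimately show ?thesis
    by (rule borel_measurable_LIMSEQ_real[rotated])
qed

section \<open>Sign and size of the payoff\<close>

lemma impermanent_loss_nonpos: "0 < p0 \<Longrightarrow> impermanent_loss \<rho> m p0 t p \<le> 0"
  unfolding impermanent_loss_def by (simp add: mult_nonneg_nonneg)

lemma impermanent_loss_less_0:
  assumes "0 < p0" "0 < p" "exit_discount m t * p \<noteq> p0"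
  shows "impermanent_loss \<rho> m p0 t p < 0"
proof -
  have "sqrt (exit_discount m t * p) - sqrt p0 \<noteq> 0"
    using assms by simp
  then have "0 < (sqrt (exit_discount m t * p) - sqrt p0)\<^sup>2"
    by simp
  then show ?thesis
    unfolding impermanent_loss_def using assms(1) by simp
qed

text \<open>Both discount factors are at most 1, which makes the bound uniform in \<open>t\<close>;
  this yields integrability of the stopped payoff.\<close>

lemma impermanent_loss_abs_le:
  assumes "0 < p0" "0 < p" "0 \<le> t" "0 \<le> \<rho>" "0 \<le> m"
  shows "\<bar>impermanent_loss \<rho> m p0 t p\<bar> \<le> 1 / (2 * p0) * (sqrt p + sqrt p0)\<^sup>2"
proof -
  have "exit_discount m t \<le> 1" "0 < exit_discount m t"
    using assms by (simp_all add: exit_discount_def)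
  then have "sqrt (exit_discount m t * p) \<le> sqrt p" "0 \<le> sqrt (exit_discount m t * p)"
    using assms by (simp_all add: mult_left_le_one_le)
  moreover have "0 \<le> sqrt p0" using assms by simp
  ultimately have "\<bar>sqrt (exit_discount m t * p) - sqrt p0\<bar> \<le> \<bar>sqrt p + sqrt p0\<bar>"
    by linarith
  then have sq: "(sqrt (exit_discount m t * p) - sqrt p0)\<^sup>2 \<le> (sqrt p + sqrt p0)\<^sup>2"
    by (simp only: abs_le_square_iff)
  have "exp (- \<rho> * t) \<le> 1" using assms by simp
  then have "exp (- \<rho> * t) * (sqrt (exit_discount m t * p) - sqrt p0)\<^sup>2 \<le> 1 * (sqrt p + sqrt p0)\<^sup>2"
    using sq by (intro mult_mono) auto
  then show ?thesis
    using assms(1) by (simp add: impermanent_loss_def abs_mult divide_right_mono)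
qed

section \<open>Negativity of the expected payoff\<close>

text \<open>An integrable nonpositive variable that is not almost surely 0 has negative expectation.
  The sign of \<open>c\<close> enters only in the choice of a time \<open>t\<close> and in the
  comparisons built on it.\<close>

lemma expectation_stopped_impermanent_loss_neg:
  assumes B: "standard_brownian_motion M B" and P: "price_process M B p0 g \<sigma> P"
    and p0: "0 < p0" and \<sigma>: "0 < \<sigma>" and m: "0 < m" and \<rho>: "0 \<le> \<rho>"
    and d: "d = \<sigma> / 2 - g / \<sigma>" and c: "c \<noteq> 0"
  shows "prob_space.expectation M
    (stopped_payoff (impermanent_loss \<rho> m p0) P (hitting_time B c d)) < 0"
proof -
  interpret prob_space M using B by (simp add: standard_brownian_motion_def)
  have B_meas: "B t \<in> borel_measurable M" and P_meas: "P t \<in> borel_measurable M" if "0 \<le> t" for t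
    using B P that by (simp_all add: standard_brownian_motion_def price_process_def)
  have B_cont: "continuous_on {0..} (\<lambda>t. B t \<omega>)" and P_cont: "continuous_on {0..} (\<lambda>t. P t \<omega>)"
    and B0: "B 0 \<omega> = 0" if "\<omega> \<in> space M" for \<omega>
    using B P that by (simp_all add: standard_brownian_motion_def price_process_def)
  define T where "T = hitting_time B c d"
  define Y where "Y = stopped_payoff (impermanent_loss \<rho> m p0) P T"
  define L where "L = p0 * exp (\<sigma> * c)"
  have L: "0 < L" using p0 by (simp add: L_def)
  have T_meas [measurable]: "T \<in> borel_measurable M"
    unfolding T_def by (intro hitting_time_measurable B_meas B_cont)
  \<comment> \<open>On \<open>T \<omega> = \<infinity>\<close> this takes the default value 0, which
    keeps \<open>p\<close> defined everywhere; the case distinction in \<open>Y\<close> discards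
    that value.\<close>
  define \<tau> where "\<tau> \<omega> = real_of_ereal (T \<omega>)" for \<omega>
  have \<tau>_meas [measurable]: "\<tau> \<in> borel_measurable M"
    unfolding \<tau>_def[abs_def] by measurable
  have \<tau>_nonneg: "0 \<le> \<tau> \<omega>" for \<omega>
    unfolding \<tau>_def T_def by (intro real_of_ereal_pos hitting_time_nonneg)
  define p where "p \<omega> = P (\<tau> \<omega>) \<omega>" for \<omega>
  have [measurable]: "p \<in> borel_measurable M"
    unfolding p_def[abs_def]
    by (rule process_at_random_time_measurable[OF P_meas P_cont \<tau>_meas \<tau>_nonneg])
  have "Y = (\<lambda>\<omega>. if T \<omega> = \<infinity> then 0 else impermanent_loss \<rho> m p0 (\<tau> \<omega>) (p \<omega>))"
    unfolding Y_def \<tau>_def p_def by (rule ext) (simp add: stopped_payoff_def)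
  then have Y_meas: "Y \<in> borel_measurable M"
    unfolding impermanent_loss_def exit_discount_def by simp
  have price: "AE \<omega> in M. \<forall>\<tau>. T \<omega> = ereal \<tau> \<longrightarrow> P \<tau> \<omega> = L"
    using price_process_AE_eq_all[OF B P p0] AE_space
  proof eventually_elim
    case (elim \<omega>)
    show ?case
    proof (intro allI impI)
      fix \<tau> assume \<tau>: "T \<omega> = ereal \<tau>"
      then have "hitting_time B c d \<omega> \<noteq> \<infinity>" by (simp add: T_def)
      with B_cont[OF elim(2)] obtain \<tau>' where "hitting_time B c d \<omega> = ereal \<tau>'" "0 \<le> \<tau>'"
        "B \<tau>' \<omega> = c + d * \<tau>'"
        by (rule hitting_time_attained)
      with \<tau> have hit: "0 \<le> \<tau>" "B \<tau> \<omega> = c + d * \<tau>"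
        by (simp_all add: T_def)
      \<comment> \<open>The slope \<open>d\<close> is chosen so that the drift of the log price
        cancels on the line.\<close>
      have "(g - \<sigma>\<^sup>2 / 2) * \<tau> + \<sigma> * (c + d * \<tau>) = \<sigma> * c"
        using \<sigma> by (simp add: d field_simps power2_eq_square)
      then show "P \<tau> \<omega> = L"
        using elim(1) hit by (simp add: L_def)
    qed
  qed
  have Y_eq: "AE \<omega> in M. \<forall>\<tau>. T \<omega> = ereal \<tau> \<longrightarrow> Y \<omega> = impermanent_loss \<rho> m p0 \<tau> L"
    using price by eventually_elim (auto simp: Y_def stopped_payoff_def)
  have Y_nonpos: "Y \<omega> \<le> 0" for \<omega>
    by (simp add: Y_def stopped_payoff_def impermanent_loss_nonpos p0)
  have "AE \<omega> in M. \<bar>Y \<omega>\<bar> \<le> 1 / (2 * p0) * (sqrt L + sqrt p0)\<^sup>2"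
    using Y_eq
  proof eventually_elim
    case (elim \<omega>)
    show ?case
    proof (cases "T \<omega>")
      case (real \<tau>)
      then have "0 \<le> \<tau>" using hitting_time_nonneg[of B c d \<omega>] by (simp add: T_def)
      then show ?thesis
        using elim real impermanent_loss_abs_le[OF p0 L _ \<rho>] m by simp
    next
      case PInf then show ?thesis using p0 by (simp add: Y_def stopped_payoff_def)
    next
      case MInf then show ?thesis using hitting_time_nonneg[of B c d \<omega>] by (simp add: T_def)
    qed
  qed
  then have Y_int: "integrable M Y"
    using Y_meas by (intro integrable_const_bound) auto

  \<comment> \<open>For \<open>c > 0\<close> this is half of the only time at which the payoff at
    level \<open>L\<close> vanishes. For \<open>c < 0\<close> that time is negative, and 1 is an
    arbitrary positive choice.\<close>
  define t where "t = (if c > 0 then \<sigma> * c / (2 * m) else 1)"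
  have t: "0 < t" using \<sigma> m by (simp add: t_def)
  \<comment> \<open>A unit interval beyond the line at time \<open>t\<close>, on the side away from
    the starting point; a path ending there has crossed the line by time \<open>t\<close>.\<close>
  define J where "J = (if c > 0 then {c + d * t<..<c + d * t + 1} else {c + d * t - 1<..<c + d * t})"
  have Bt: "distributed M lborel (\<lambda>\<omega>. B t \<omega> - B 0 \<omega>) (normal_density 0 (sqrt t))"
  proof -
    have "distributed M lborel (\<lambda>\<omega>. B t \<omega> - B 0 \<omega>) (normal_density 0 (sqrt (t - 0)))"
      using B t unfolding standard_brownian_motion_def by blast
    then show ?thesis by simp
  qed
  have not_AE: "\<not> (AE \<omega> in M. B t \<omega> - B 0 \<omega> \<notin> J)"
    using normal_prob_interval_pos[OF prob_space_axioms t Bt, of "c + d * t" "c + d * t + 1"]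
      normal_prob_interval_pos[OF prob_space_axioms t Bt, of "c + d * t - 1" "c + d * t"]
    by (simp add: J_def)
  have hit: "\<exists>\<tau>. T \<omega> = ereal \<tau> \<and> 0 \<le> \<tau> \<and> \<tau> \<le> t" if \<omega>: "\<omega> \<in> space M" "B t \<omega> \<in> J" for \<omega>
  proof -
    define F where "F r = B r \<omega> - (c + d * r)" for r
    have F: "continuous_on {0..t} F"
      unfolding F_def
      by (intro continuous_intros continuous_on_subset[OF B_cont[OF \<omega>(1)]]) auto
    have "\<exists>r. 0 \<le> r \<and> r \<le> t \<and> F r = 0"
    proof (cases "c > 0")
      case True
      then have "F 0 \<le> 0" "0 \<le> F t"
        using \<omega> by (simp_all add: F_def B0 J_def)
      then show ?thesis using IVT'[of F 0 0 t] F t by auto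
    next
      case False
      then have "0 \<le> F 0" "F t \<le> 0"
        using \<omega> by (simp_all add: F_def B0 J_def)
      then show ?thesis using IVT2'[of F t 0 0] F t by auto
    qed
    then obtain r where r: "0 \<le> r" "r \<le> t" "B r \<omega> = c + d * r"
      by (auto simp: F_def)
    then have "hitting_time B c d \<omega> \<noteq> \<infinity>" by (auto simp: hitting_time_eq_infinity_iff)
    with B_cont[OF \<omega>(1)] obtain z where z: "hitting_time B c d \<omega> = ereal z" "0 \<le> z"
      "B z \<omega> = c + d * z" "\<forall>s. 0 \<le> s \<longrightarrow> B s \<omega> = c + d * s \<longrightarrow> z \<le> s"
      by (rule hitting_time_attained)
    have "z \<le> r" using z(4) r(1,3) by blast
    then have "z \<le> t" using r(2) by (rule order_trans)
    with z(1,2) show ?thesis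
      unfolding T_def by blast
  qed
  have "\<not> (AE \<omega> in M. - Y \<omega> = 0)"
  proof
    assume "AE \<omega> in M. - Y \<omega> = 0"
    with Y_eq AE_space have "AE \<omega> in M. B t \<omega> - B 0 \<omega> \<notin> J"
    proof eventually_elim
      case (elim \<omega>)
      show ?case
      proof
        assume "B t \<omega> - B 0 \<omega> \<in> J"
        then have "B t \<omega> \<in> J" using elim by (simp add: B0)
        then obtain \<tau> where \<tau>: "T \<omega> = ereal \<tau>" "0 \<le> \<tau>" "\<tau> \<le> t"
          using hit elim by blast
        have "m * \<tau> \<noteq> \<sigma> * c"
        proof (cases "c > 0")
          case True
          then have "m * t < \<sigma> * c" using m \<sigma> by (simp add: t_def)
          moreover have "m * \<tau> \<le> m * t" using \<tau> m by simp
          ultimately show ?thesis by simp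
        next
          case False
          then have "\<sigma> * c < 0" using c \<sigma> by (simp add: mult_pos_neg)
          moreover have "0 \<le> m * \<tau>" using \<tau> m by simp
          ultimately show ?thesis by simp
        qed
        \<comment> \<open>This exponential is the ratio of the discounted price to
          \<open>p0\<close>; the payoff vanishes only where it equals 1.\<close>
        then have "exp (- m * \<tau> + \<sigma> * c) \<noteq> 1" by simp
        then have "exit_discount m \<tau> * L \<noteq> p0"
          using p0 by (simp add: exit_discount_def L_def exp_add[symmetric])
        then show False
          using impermanent_loss_less_0[OF p0 L, of m \<tau> \<rho>] elim \<tau>(1) by simp
      qed
    qed
    with not_AE show False ..
  qed
  then have "expectation (\<lambda>\<omega>. - Y \<omega>) \<noteq> 0"
    using Y_int Y_nonpos by (subst integral_nonneg_eq_0_iff_AE) auto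
  moreover have "0 \<le> expectation (\<lambda>\<omega>. - Y \<omega>)"
    by (rule Bochner_Integration.integral_nonneg) (simp add: Y_nonpos)
  ultimately show ?thesis by (simp add: Y_def T_def)
qed

theorem proposition4p6:
  fixes M :: "'a measure" and B P :: "real \<Rightarrow> 'a \<Rightarrow> real"
    and p0 g \<sigma> m r \<rho> d :: real
  assumes B: "standard_brownian_motion M B"
    and P: "price_process M B p0 g \<sigma> P"
    and params: "0 \<le> g" "0 < \<sigma>" "0 < m" "0 \<le> r" "0 \<le> \<rho>"
    and token: "(p0 = 1 \<and> g = 0 \<and> 0 < r) \<or> (1 < p0 \<and> 0 < g \<and> r = 0)"
    and d_eq: "d = \<sigma> / 2 - g / \<sigma>"
    and A1: "ln p0 < r + g - \<rho> - m" "0 < ln p0"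
    and A2: "0 < (\<sigma> / 2 - g / \<sigma>)\<^sup>2 - 2 * (g + r - m - \<rho>)"
    and A3: "0 < (\<sigma> / 2 - g / \<sigma>)\<^sup>2 - (g - (1 / 4) * \<sigma>\<^sup>2 - m - 2 * \<rho>)"
    and A4: "0 < d"
    and A5: "0 < (1 / 4) * \<sigma>\<^sup>2 - m"
  shows "(\<forall>c>0. prob_space.expectation M
            (stopped_payoff (impermanent_loss \<rho> m p0) P (hitting_time B c d)) < 0) \<and>
         (\<forall>c<0. prob_space.expectation M
            (stopped_payoff (impermanent_loss \<rho> m p0) P (hitting_time B c d)) < 0)"
proof -
  have "0 < p0" using token by auto
  then show ?thesis
    using expectation_stopped_impermanent_loss_neg[OF B P _ params(2,3,5) d_eq] by auto
qed

end
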